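(* Let $(\beta,\alpha)$ be the tautological kernel of complex hyperbolic type on the complex geodesic $\mathbf{H}_{\mathbf{C}}^1$, i.e. $\beta(x,y)=\cosh d(x,y)$ and $\alpha(x,y,z)=\mathrm{Cart}(x,y,z)$ for $x,y,z\in\mathbf{H}_{\mathbf{C}}^1$, and let $0\leq t\leq 1$ and $s\in\mathbf{R}$. Then $(\beta^t,s\alpha)$ is of complex hyperbolic type only if $s=\pm t$.
   Context: Let $B(z\oplus u,w\oplus v)=\overline{z}w-\overline{u}v$ on $\mathbf{C}\oplus\mathbf{C}$. The complex geodesic $\mathbf{H}_{\mathbf{C}}^1$ is the projectivisation of the set of $B$-positive vectors, with distance $\cosh d(x,y)=|B(X,Y)|/(B(X,X)B(Y,Y))^{1/2}$ for any representatives $X,Y$ of $x,y$. The Cartan argument $\mathrm{Cart}(x,y,z)\in(-\tfrac\pi2,\tfrac\pi2)$ of three points represented by positive vectors $X,Y,Z$ is the argument of $B(X,Y)B(Y,Z)B(Z,X)$ (which has positive real part). A function $\Phi\colon X\times X\to\mathbf{C}$ is a kernel of (complex) positive type if $\sum_{j,k}\overline{c_j}c_k\Phi(x_j,x_k)\geq 0$ for all finite families $c_j\in\mathbf{C}$, $x_j\in X$. A function $\alpha\colon X^3\to\mathbf{R}$ is a $2$-cocycle if $\alpha(x_1,x_2,x_3)-\alpha(x_0,x_2,x_3)+\alpha(x_0,x_1,x_3)-\alpha(x_0,x_1,x_2)=0$ for all $x_i$; it is alternating if permuting its variables multiplies it by the sign of the permutation. A kernel of complex hyperbolic type on a set $X$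 is a pair $(\beta,\alpha)$ with $\beta\colon X^2\to\mathbf{R}_{\geq 0}$, $\alpha\colon X^3\to(-\tfrac\pi2,\tfrac\pi2)$ such that $\beta=1$ on the diagonal, $\alpha$ is an alternating $2$-cocycle, and for all $x_0\in X$ the kernel $(x,y)\mapsto\beta(x,x_0)\beta(x_0,y)-e^{i\alpha(x_0,x,y)}\beta(x,y)$ is of complex positive type. *)

theory Defs
  imports "HOL-Analysis.Analysis" "HOL-Combinatorics.Permutations"
begin

definition pos_type_on :: "'a set \<Rightarrow> ('a \<Rightarrow> 'a \<Rightarrow> complex) \<Rightarrow> bool" where
  "pos_type_on X \<Phi> \<longleftrightarrow>
     (\<forall>(n::nat) (c :: nat \<Rightarrow> complex) (x :: nat \<Rightarrow> 'a). (\<forall>j<n. x j \<in> X) \<longrightarrow>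
        (\<Sum>j<n. \<Sum>k<n. cnj (c j) * c k * \<Phi> (x j) (x k)) \<in> \<real>\<^sub>\<ge>\<^sub>0)"

definition cocycle_on :: "'a set \<Rightarrow> ('a \<Rightarrow> 'a \<Rightarrow> 'a \<Rightarrow> real) \<Rightarrow> bool" where
  "cocycle_on X \<alpha> \<longleftrightarrow>
     (\<forall>x0\<in>X. \<forall>x1\<in>X. \<forall>x2\<in>X. \<forall>x3\<in>X.
        \<alpha> x1 x2 x3 - \<alpha> x0 x2 x3 + \<alpha> x0 x1 x3 - \<alpha> x0 x1 x2 = 0)"

definition alternating_on :: "'a set \<Rightarrow> ('a \<Rightarrow> 'a \<Rightarrow> 'a \<Rightarrow> real) \<Rightarrow> bool" where
  "alternating_on X \<alpha> \<longleftrightarrow>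
     (\<forall>x :: nat \<Rightarrow> 'a. (\<forall>i<3. x i \<in> X) \<longrightarrow>
        (\<forall>p. p permutes {..<3} \<longrightarrow>
           \<alpha> (x (p 0)) (x (p 1)) (x (p 2)) = of_int (sign p) * \<alpha> (x 0) (x 1) (x 2)))"

definition complex_hyperbolic_type ::
    "'a set \<Rightarrow> ('a \<Rightarrow> 'a \<Rightarrow> real) \<Rightarrow> ('a \<Rightarrow> 'a \<Rightarrow> 'a \<Rightarrow> real) \<Rightarrow> bool" where
  "complex_hyperbolic_type X \<beta> \<alpha> \<longleftrightarrow>
     (\<forall>x\<in>X. \<forall>y\<in>X. 0 \<le> \<beta> x y) \<and>
     (\<forall>x\<in>X. \<forall>y\<in>X. \<forall>z\<in>X. - (pi / 2) < \<alpha> x y z \<and> \<alpha> x y z < pi / 2) \<and>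
     (\<forall>x\<in>X. \<beta> x x = 1) \<and>
     alternating_on X \<alpha> \<and>
     cocycle_on X \<alpha> \<and>
     (\<forall>x0\<in>X. pos_type_on X
        (\<lambda>x y. of_real (\<beta> x x0 * \<beta> x0 y) - cis (\<alpha> x0 x y) * of_real (\<beta> x y)))"

definition B :: "complex \<times> complex \<Rightarrow> complex \<times> complex \<Rightarrow> complex" where
  "B X Y = cnj (fst X) * fst Y - cnj (snd X) * snd Y"

text \<open>\<open>B X X\<close> is always real, see \<open>B_self\<close> below.\<close>

definition pos_vectors :: "(complex \<times> complex) set" where
  "pos_vectors = {X. 0 < Re (B X X)}"

definition proj_rel :: "((complex \<times> complex) \<times> (complex \<times> complex)) set" where
  "proj_rel = {(X, Y). X \<in> pos_vectors \<and> Y \<in> pos_vectors \<and>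
     (\<exists>c. c \<noteq> 0 \<and> Y = (c * fst X, c * snd X))}"

definition HC1 :: "(complex \<times> complex) set set" where
  "HC1 = pos_vectors // proj_rel"

definition rep :: "(complex \<times> complex) set \<Rightarrow> complex \<times> complex" where
  "rep x = (SOME X. X \<in> x)"

text \<open>The lemmas \<open>cosh_hdist\<close> and \<open>Cart_eq\<close> below show that the following two notions do not
  depend on the chosen representatives.\<close>

definition hdist :: "(complex \<times> complex) set \<Rightarrow> (complex \<times> complex) set \<Rightarrow> real" where
  "hdist x y = arcosh (cmod (B (rep x) (rep y)) /
     sqrt (Re (B (rep x) (rep x)) * Re (B (rep y) (rep y))))"

definition Cart ::
    "(complex \<times> complex) set \<Rightarrow> (complex \<times> complex) set \<Rightarrow> (complex \<times> complex) set \<Rightarrow> real" where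
  "Cart x y z = Arg (B (rep x) (rep y) * B (rep y) (rep z) * B (rep z) (rep x))"

lemma B_self: "B X X = of_real ((cmod (fst X))\<^sup>2 - (cmod (snd X))\<^sup>2)"
  by (simp add: B_def complex_norm_square mult.commute del: of_real_power)

lemma B_cnj: "cnj (B X Y) = B Y X"
  by (simp add: B_def mult.commute)

lemma B_scale:
  "B (a * fst X, a * snd X) (b * fst Y, b * snd Y) = cnj a * b * B X Y"
  by (simp add: B_def algebra_simps)

lemma equiv_proj_rel: "equiv pos_vectors proj_rel"
proof (rule equivI)
  show "proj_rel \<subseteq> pos_vectors \<times> pos_vectors"
    by (auto simp: proj_rel_def)
  show "refl_on pos_vectors proj_rel"
    by (auto simp: refl_on_def proj_rel_def intro!: exI[of _ 1])
  show "sym proj_rel"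
  proof (rule symI)
    fix X Y assume "(X, Y) \<in> proj_rel"
    then obtain c where c: "X \<in> pos_vectors" "Y \<in> pos_vectors" "c \<noteq> 0"
      "Y = (c * fst X, c * snd X)"
      by (auto simp: proj_rel_def)
    then have "X = (inverse c * fst Y, inverse c * snd Y)" "inverse c \<noteq> 0"
      by (auto simp: prod_eq_iff)
    with c show "(Y, X) \<in> proj_rel"
      unfolding proj_rel_def by blast
  qed
  show "trans proj_rel"
  proof (rule transI)
    fix X Y Z assume "(X, Y) \<in> proj_rel" "(Y, Z) \<in> proj_rel"
    then obtain c d where "X \<in> pos_vectors" "Z \<in> pos_vectors" "c \<noteq> 0" "d \<noteq> 0"
      "Y = (c * fst X, c * snd X)" "Z = (d * fst Y, d * snd Y)"
      by (auto simp: proj_rel_def)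
    then have "X \<in> pos_vectors" "Z \<in> pos_vectors" "d * c \<noteq> 0"
      "Z = (d * c * fst X, d * c * snd X)"
      by auto
    then show "(X, Z) \<in> proj_rel"
      unfolding proj_rel_def by blast
  qed
qed

lemma HC1_rep:
  assumes "x \<in> HC1" and "X \<in> x"
  shows "X \<in> pos_vectors" "rep x \<in> x" "rep x \<in> pos_vectors"
    "\<exists>c. c \<noteq> 0 \<and> rep x = (c * fst X, c * snd X)"
proof -
  have r: "rep x \<in> x"
    unfolding rep_def using assms(2) by (rule someI)
  with assms have "(X, rep x) \<in> proj_rel"
    unfolding HC1_def by (meson equiv_proj_rel quotient_eq_iff)
  then show "X \<in> pos_vectors" "rep x \<in> pos_vectors"
    "\<exists>c. c \<noteq> 0 \<and> rep x = (c * fst X, c * snd X)"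
    by (auto simp: proj_rel_def)
  show "rep x \<in> x" by (rule r)
qed

lemma reverse_Cauchy_Schwarz:
  assumes "X \<in> pos_vectors" "Y \<in> pos_vectors"
  shows "Re (B X X) * Re (B Y Y) \<le> (cmod (B X Y))\<^sup>2"
proof -
  have "(cmod (B X Y))\<^sup>2 - Re (B X X) * Re (B Y Y) = (cmod (fst X * snd Y - snd X * fst Y))\<^sup>2"
    unfolding B_def cmod_power2 by (simp add: algebra_simps power2_eq_square)
  then show ?thesis
    by (metis diff_ge_0_iff_ge zero_le_power2)
qed

lemma cosh_hdist:
  assumes "x \<in> HC1" "y \<in> HC1" "X \<in> x" "Y \<in> y"
  shows "cosh (hdist x y) = cmod (B X Y) / sqrt (Re (B X X) * Re (B Y Y))"
proof -
  obtain a where a: "a \<noteq> 0" "rep x = (a * fst X, a * snd X)"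
    using HC1_rep(4)[OF assms(1,3)] by blast
  obtain b where b: "b \<noteq> 0" "rep y = (b * fst Y, b * snd Y)"
    using HC1_rep(4)[OF assms(2,4)] by blast
  have pX: "X \<in> pos_vectors" and pY: "Y \<in> pos_vectors"
    using HC1_rep(1) assms by auto
  have sc: "Re (B (c * fst Z, c * snd Z) (c * fst Z, c * snd Z)) = (cmod c)\<^sup>2 * Re (B Z Z)" for c Z
    unfolding B_self by (simp add: norm_mult power_mult_distrib algebra_simps)
  have eq: "cmod (B (rep x) (rep y)) / sqrt (Re (B (rep x) (rep x)) * Re (B (rep y) (rep y)))
      = cmod (B X Y) / sqrt (Re (B X X) * Re (B Y Y))"
    unfolding a(2) b(2) sc unfolding B_scale
    using a(1) b(1) by (simp add: norm_mult real_sqrt_mult)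
  have pos: "0 < Re (B X X) * Re (B Y Y)"
    using pX pY by (simp add: pos_vectors_def)
  have "sqrt (Re (B X X) * Re (B Y Y)) \<le> cmod (B X Y)"
    using reverse_Cauchy_Schwarz[OF pX pY] by (simp add: real_le_lsqrt)
  then have "1 \<le> cmod (B X Y) / sqrt (Re (B X X) * Re (B Y Y))"
    using pos by (simp add: field_simps)
  then show ?thesis
    unfolding hdist_def eq by (rule cosh_arcosh_real)
qed

lemma triple_product_pos:
  assumes "X \<in> pos_vectors" "Y \<in> pos_vectors" "Z \<in> pos_vectors"
  shows "0 < Re (B X Y * B Y Z * B Z X)"
proof -
  let ?a = "Re (B X X)" and ?b = "Re (B Y Y)" and ?c = "Re (B Z Z)"
  have "B X Y * B Y Z * B Z X + B Y X * B Z Y * B X Z =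
      B X X * (B Y Z * B Z Y) + B Y Y * (B X Z * B Z X) + B Z Z * (B X Y * B Y X)
      - B X X * B Y Y * B Z Z"
    unfolding B_def by (simp add: algebra_simps)
  moreover have "B Y X * B Z Y * B X Z = cnj (B X Y * B Y Z * B Z X)"
    by (simp add: B_cnj)
  moreover have "B U V * B V U = of_real ((cmod (B U V))\<^sup>2)" for U V
    by (simp add: complex_norm_square B_cnj del: of_real_power)
  moreover have "B U U = of_real (Re (B U U))" for U
    by (simp add: B_self)
  ultimately have "complex_of_real (2 * Re (B X Y * B Y Z * B Z X)) =
      of_real (?a * (cmod (B Y Z))\<^sup>2 + ?b * (cmod (B X Z))\<^sup>2 + ?c * (cmod (B X Y))\<^sup>2
        - ?a * ?b * ?c)"
    by (metis (no_types, lifting) complex_add_cnj of_real_add of_real_diff of_real_mult)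
  then have gram: "2 * Re (B X Y * B Y Z * B Z X) =
      ?a * (cmod (B Y Z))\<^sup>2 + ?b * (cmod (B X Z))\<^sup>2 + ?c * (cmod (B X Y))\<^sup>2 - ?a * ?b * ?c"
    by (simp only: of_real_eq_iff)
  have abc: "0 < ?a" "0 < ?b" "0 < ?c"
    using assms by (auto simp: pos_vectors_def)
  have "?a * (?b * ?c) \<le> ?a * (cmod (B Y Z))\<^sup>2" "?b * (?a * ?c) \<le> ?b * (cmod (B X Z))\<^sup>2"
    "?c * (?a * ?b) \<le> ?c * (cmod (B X Y))\<^sup>2"
    using abc assms by (auto intro!: mult_left_mono reverse_Cauchy_Schwarz)
  moreover have "0 < ?a * ?b * ?c"
    using abc by simp
  ultimately show ?thesis
    using gram by (simp add: algebra_simps)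
qed

lemma Cart_eq:
  assumes "x \<in> HC1" "y \<in> HC1" "z \<in> HC1" "X \<in> x" "Y \<in> y" "Z \<in> z"
  shows "Cart x y z = Arg (B X Y * B Y Z * B Z X)"
proof -
  obtain a where a: "a \<noteq> 0" "rep x = (a * fst X, a * snd X)"
    using HC1_rep(4)[OF assms(1,4)] by blast
  obtain b where b: "b \<noteq> 0" "rep y = (b * fst Y, b * snd Y)"
    using HC1_rep(4)[OF assms(2,5)] by blast
  obtain c where c: "c \<noteq> 0" "rep z = (c * fst Z, c * snd Z)"
    using HC1_rep(4)[OF assms(3,6)] by blast
  have "B (rep x) (rep y) * B (rep y) (rep z) * B (rep z) (rep x) =
      of_real ((cmod a)\<^sup>2 * (cmod b)\<^sup>2 * (cmod c)\<^sup>2) * (B X Y * B Y Z * B Z X)"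
    unfolding a(2) b(2) c(2) B_scale
    by (simp add: complex_norm_square algebra_simps del: of_real_power)
  moreover have "0 < (cmod a)\<^sup>2 * (cmod b)\<^sup>2 * (cmod c)\<^sup>2"
    using a(1) b(1) c(1) by simp
  ultimately show ?thesis
    unfolding Cart_def by (simp only: Arg_times_of_real)
qed

lemma Cart_bounds:
  assumes "x \<in> HC1" "y \<in> HC1" "z \<in> HC1"
  shows "- (pi / 2) < Cart x y z" "Cart x y z < pi / 2"
proof -
  have p: "rep u \<in> pos_vectors" if u: "u \<in> HC1" for u
  proof -
    obtain U where "U \<in> u"
      using in_quotient_imp_non_empty[OF equiv_proj_rel] u unfolding HC1_def by blast
    then show ?thesis
      using HC1_rep(3) u by blast
  qed
  have "\<bar>Cart x y z\<bar> < pi / 2"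
    unfolding Cart_def using triple_product_pos[OF p p p, OF assms] by (rule Arg_Re_pos[THEN iffD2, OF disjI1])
  then show "- (pi / 2) < Cart x y z" "Cart x y z < pi / 2"
    by auto
qed

end

theory Submission
  imports Defs "HOL-Real_Asymp.Real_Asymp"
begin

text \<open>In the disc model, with the origin as base point and up to a positive rank one factor, the
  kernel is \<open>1 - (1 - u)\<^bsup>a\<^esup> (1 - cnj u)\<^bsup>b\<^esup>\<close> with \<open>u = cnj z * w\<close>, \<open>a = (t + s) / 2\<close> and
  \<open>b = (t - s) / 2\<close>. Positivity on small circles forces the coefficients \<open>a\<close>, \<open>b\<close> and \<open>- a * b\<close>
  of \<open>u\<close>, \<open>cnj u\<close> and \<open>u * cnj u\<close> in its expansion to be nonnegative, hence \<open>a * b = 0\<close>. The points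
  \<open>sqrt q * \<i>\<^sup>j\<close> with \<open>q\<close> tending to \<open>0\<close> suffice to see this.\<close>

definition disc_point :: "complex \<Rightarrow> (complex \<times> complex) set" where
  "disc_point z = proj_rel `` {(1, z)}"

lemma disc_point:
  assumes "cmod z < 1"
  shows "disc_point z \<in> HC1" "(1, z) \<in> disc_point z"
proof -
  have "(cmod z)\<^sup>2 < 1"
    using assms by (simp add: abs_square_less_1)
  then have "(1, z) \<in> pos_vectors"
    by (simp add: pos_vectors_def B_self del: of_real_diff of_real_power)
  then show "disc_point z \<in> HC1" "(1, z) \<in> disc_point z"
    using equiv_class_self[OF equiv_proj_rel] unfolding disc_point_def HC1_def
    by (auto intro: quotientI)
qed

lemma cosh_hdist_disc_point:
  assumes "cmod z < 1" "cmod w < 1"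
  shows "cosh (hdist (disc_point z) (disc_point w)) =
    cmod (1 - cnj z * w) / sqrt ((1 - (cmod z)\<^sup>2) * (1 - (cmod w)\<^sup>2))"
  using cosh_hdist[OF disc_point(1)[OF assms(1)] disc_point(1)[OF assms(2)]
      disc_point(2)[OF assms(1)] disc_point(2)[OF assms(2)]]
  by (simp add: B_self del: of_real_diff of_real_power) (simp add: B_def)

text \<open>With \<open>(1, 0)\<close> representing the base point, the first and last factors of
  the triple product equal \<open>1\<close>.\<close>

lemma Cart_disc_point:
  assumes "cmod z < 1" "cmod w < 1"
  shows "Cart (disc_point 0) (disc_point z) (disc_point w) = Arg (1 - cnj z * w)"
  using Cart_eq[OF disc_point(1)[of 0] disc_point(1)[OF assms(1)] disc_point(1)[OF assms(2)]
      disc_point(2)[of 0] disc_point(2)[OF assms(1)] disc_point(2)[OF assms(2)]]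
  by (simp add: B_def)

text \<open>\<open>twisted_power t s v\<close> is \<open>v\<close> to the power \<open>(t + s) / 2\<close> times \<open>cnj v\<close> to the power
  \<open>(t - s) / 2\<close>.\<close>

definition twisted_power :: "real \<Rightarrow> real \<Rightarrow> complex \<Rightarrow> complex" where
  "twisted_power t s v = of_real (cmod v powr t) * cis (s * Arg v)"

text \<open>If \<open>u\<close> is \<open>q\<close> times a fourth root of unity and
  \<open>0 < q < 1\<close>, then \<open>1 - u\<close> is a positive real or
  \<open>1 + \<i> * y\<close> with \<open>y = q\<close> or \<open>y = - q\<close>. So this lemma and
  the next evaluate every entry of the test sums.\<close>

lemma twisted_power_of_real:
  assumes "0 < v"
  shows "twisted_power t s (of_real v) = of_real (v powr t)"
  using assms Arg_times_of_real[of v 1] by (simp add: twisted_power_def)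

lemma twisted_power_one_plus_imag:
  "twisted_power t s (1 + \<i> * of_real y) =
     of_real ((1 + y\<^sup>2) powr (t / 2)) * cis (s * arctan y)"
proof -
  have "cmod (1 + \<i> * of_real y) = (1 + y\<^sup>2) powr (1 / 2)"
    by (simp add: cmod_def powr_half_sqrt)
  moreover have "Arg (1 + \<i> * of_real y) = arctan y"
    by (subst arg_conv_arctan) auto
  ultimately show ?thesis
    by (simp add: twisted_power_def powr_powr)
qed

lemma pos_type_on_cong:
  assumes "pos_type_on X \<Phi>" and eq: "\<And>x y. x \<in> X \<Longrightarrow> y \<in> X \<Longrightarrow> \<Phi> x y = \<Psi> x y"
  shows "pos_type_on X \<Psi>"
  unfolding pos_type_on_def
proof (intro allI impI)
  fix n :: nat and c :: "nat \<Rightarrow> complex" and x :: "nat \<Rightarrow> 'a"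
  assume x: "\<forall>j<n. x j \<in> X"
  then have "(\<Sum>j<n. \<Sum>k<n. cnj (c j) * c k * \<Psi> (x j) (x k)) =
      (\<Sum>j<n. \<Sum>k<n. cnj (c j) * c k * \<Phi> (x j) (x k))"
    by (intro sum.cong refl) (simp add: eq)
  with assms(1) x show "(\<Sum>j<n. \<Sum>k<n. cnj (c j) * c k * \<Psi> (x j) (x k)) \<in> \<real>\<^sub>\<ge>\<^sub>0"
    unfolding pos_type_on_def by simp
qed

definition deformed_kernel ::
    "real \<Rightarrow> real \<Rightarrow> (complex \<times> complex) set \<Rightarrow> (complex \<times> complex) set \<Rightarrow>
      (complex \<times> complex) set \<Rightarrow> complex" where
  "deformed_kernel t s x0 x y =
     of_real (cosh (hdist x x0) powr t * cosh (hdist x0 y) powr t) -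
     cis (s * Cart x0 x y) * of_real (cosh (hdist x y) powr t)"

text \<open>On a circle about the base point the factors normalising the representatives are
  constant, so only the numerator of \<open>\<beta>\<close> matters.\<close>

lemma twisted_power_kernel_on_circle:
  fixes c \<zeta> :: "nat \<Rightarrow> complex" and n :: nat
  assumes pos: "pos_type_on HC1 (deformed_kernel t s (disc_point 0))"
    and q: "0 < q" "q < 1" and \<zeta>: "\<And>j. j < n \<Longrightarrow> cmod (\<zeta> j) = 1"
  shows "(\<Sum>j<n. \<Sum>k<n. cnj (c j) * c k *
           (1 - twisted_power t s (1 - of_real q * (cnj (\<zeta> j) * \<zeta> k)))) \<in> \<real>\<^sub>\<ge>\<^sub>0"
proof -
  define z where "z j = of_real (sqrt q) * \<zeta> j" for j
  define N where "N = (1 - q) powr t"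
  have z: "cmod (z j) < 1" "(cmod (z j))\<^sup>2 = q" if "j < n" for j
    using that q \<zeta> by (auto simp: z_def norm_mult)
  have N: "N > 0"
    using q by (simp add: N_def)
  define \<Phi> where "\<Phi> j k = deformed_kernel t s (disc_point 0) (disc_point (z j)) (disc_point (z k))"
    for j k
  have nonneg: "(\<Sum>j<n. \<Sum>k<n. cnj (c j) * c k * \<Phi> j k) \<in> \<real>\<^sub>\<ge>\<^sub>0"
    using pos z(1) disc_point(1) unfolding pos_type_on_def \<Phi>_def by simp
  have rescale: "1 - twisted_power t s (1 - of_real q * (cnj (\<zeta> j) * \<zeta> k)) = of_real N * \<Phi> j k"
    if "j < n" "k < n" for j k
  proof -
    define v where "v = 1 - of_real q * (cnj (\<zeta> j) * \<zeta> k)"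
    have "cnj (z j) * z k = of_real (sqrt q * sqrt q) * (cnj (\<zeta> j) * \<zeta> k)"
      unfolding z_def of_real_mult by (simp add: algebra_simps)
    then have v: "1 - cnj (z j) * z k = v"
      using q by (simp add: v_def)
    \<comment> \<open>Two distances to the base point contribute \<open>sqrt (1 - q)\<close> each to
      the denominator, the mutual distance contributes \<open>1 - q\<close>: both terms of the
      kernel carry \<open>1 / N\<close>.\<close>
    have "cosh (hdist (disc_point (z j)) (disc_point 0)) powr t *
        cosh (hdist (disc_point 0) (disc_point (z k))) powr t = 1 / N"
      using that z q
      by (simp add: cosh_hdist_disc_point N_def flip: powr_mult) (simp add: powr_divide)
    moreover have "cosh (hdist (disc_point (z j)) (disc_point (z k))) powr t = cmod v powr t / N"
      using that z q by (simp add: cosh_hdist_disc_point v N_def powr_divide)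
    moreover have "Cart (disc_point 0) (disc_point (z j)) (disc_point (z k)) = Arg v"
      using that z by (simp add: Cart_disc_point v)
    ultimately have "\<Phi> j k = of_real (1 / N) - cis (s * Arg v) * of_real (cmod v powr t / N)"
      unfolding \<Phi>_def deformed_kernel_def by (simp only:)
    then show ?thesis
      unfolding v_def[symmetric] twisted_power_def using N by (simp add: field_simps)
  qed
  have "(\<Sum>j<n. \<Sum>k<n. cnj (c j) * c k *
        (1 - twisted_power t s (1 - of_real q * (cnj (\<zeta> j) * \<zeta> k)))) =
      of_real N * (\<Sum>j<n. \<Sum>k<n. cnj (c j) * c k * \<Phi> j k)"
    by (simp add: sum_distrib_left rescale mult.left_commute cong: sum.cong_simp)
  also have "\<dots> \<in> \<real>\<^sub>\<ge>\<^sub>0"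
    using N nonneg by (intro nonneg_Reals_mult_I) auto
  finally show ?thesis .
qed

text \<open>Test points \<open>sqrt q\<close> and \<open>sqrt q * \<i>\<close> with weights
  \<open>1\<close> and \<open>\<sigma> * \<i>\<close>: off the diagonal the constants
  \<open>1\<close> cancel and the sine, odd in \<open>s\<close>, remains. The sum is twice the
  bound.\<close>

lemma two_point_inequality:
  assumes pos: "pos_type_on HC1 (deformed_kernel t s (disc_point 0))"
    and q: "0 < q" "q < 1" and \<sigma>: "\<sigma> = 1 \<or> \<sigma> = -1"
  shows "0 \<le> 1 - (1 - q) powr t - (1 + q\<^sup>2) powr (t / 2) * sin (\<sigma> * s * arctan q)"
proof -
  have "(\<Sum>j<2::nat. \<Sum>k<2. cnj ((of_real \<sigma> * \<i>) ^ j) * (of_real \<sigma> * \<i>) ^ k *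
      (1 - twisted_power t s (1 - of_real q * (cnj (\<i> ^ j) * \<i> ^ k)))) \<in> \<real>\<^sub>\<ge>\<^sub>0"
    by (rule twisted_power_kernel_on_circle[OF pos q]) (simp add: norm_power)
  then show ?thesis
    using \<sigma> twisted_power_of_real[of "1 - q" t s] twisted_power_one_plus_imag[of t s q]
      twisted_power_one_plus_imag[of t s "- q"] q
    by (auto simp: numeral_2_eq_2 arctan_minus complex_nonneg_Reals_iff mult.commute)
qed

text \<open>Equal weights average over the fourth roots of unity, killing each monomial
  \<open>u^m * cnj u^n\<close> with \<open>m - n\<close> not divisible by 4. The lowest term that
  can survive is \<open>u * cnj u\<close>, of order \<open>q^2\<close>.\<close>

lemma four_point_inequality:
  assumes pos: "pos_type_on HC1 (deformed_kernel t s (disc_point 0))"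
    and q: "0 < q" "q < 1"
  shows "0 \<le> 4 - (1 - q) powr t - (1 + q) powr t - 2 * (1 + q\<^sup>2) powr (t / 2) * cos (s * arctan q)"
proof -
  have "(\<Sum>j<4::nat. \<Sum>k<4. cnj 1 * 1 *
      (1 - twisted_power t s (1 - of_real q * (cnj (\<i> ^ j) * \<i> ^ k)))) \<in> \<real>\<^sub>\<ge>\<^sub>0"
    by (rule twisted_power_kernel_on_circle[OF pos q]) (simp add: norm_power)
  then show ?thesis
    using twisted_power_of_real[of "1 - q" t s] twisted_power_of_real[of "1 + q" t s]
      twisted_power_one_plus_imag[of t s q] twisted_power_one_plus_imag[of t s "- q"] q
    by (auto simp: eval_nat_numeral arctan_minus complex_nonneg_Reals_iff mult.commute)
qed

lemma two_point_limit:
  "((\<lambda>q. (1 - (1 - q) powr t - (1 + q\<^sup>2) powr (t / 2) * sin (s * arctan q)) / q) \<longlongrightarrow> t - s)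
     (at_right (0::real))"
  by real_asymp

text \<open>The limit is \<open>- 4 * a * b\<close>, four times the coefficient of
  \<open>u * cnj u\<close>.\<close>

lemma four_point_limit:
  "((\<lambda>q. (4 - (1 - q) powr t - (1 + q) powr t - 2 * (1 + q\<^sup>2) powr (t / 2) * cos (s * arctan q)) / q\<^sup>2)
     \<longlongrightarrow> s\<^sup>2 - t\<^sup>2) (at_right (0::real))"
proof -
  have "((\<lambda>q. (2 - (1 - q) powr t - (1 + q) powr t) / q\<^sup>2) \<longlongrightarrow> t - t\<^sup>2) (at_right (0::real))"
    by (real_asymp simp: field_simps power2_eq_square)
  moreover have "((\<lambda>q. (1 - (1 + q\<^sup>2) powr (t / 2)) / q\<^sup>2) \<longlongrightarrow> - t / 2) (at_right (0::real))"
    by real_asymp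
  moreover have "((\<lambda>q. (1 + q\<^sup>2) powr (t / 2)) \<longlongrightarrow> 1) (at_right (0::real))"
    by real_asymp
  moreover have "((\<lambda>q. (1 - cos (s * arctan q)) / q\<^sup>2) \<longlongrightarrow> s\<^sup>2 / 2) (at_right (0::real))"
    by (real_asymp simp: field_simps power2_eq_square)
  \<comment> \<open>Regroups \<open>4 - A - B - 2 * R * C\<close> as
    \<open>(2 - A - B) + 2 * (1 - R) + 2 * R * (1 - C)\<close>; the terms linear in \<open>t\<close>
    cancel in the limit.\<close>
  ultimately have "((\<lambda>q. (2 - (1 - q) powr t - (1 + q) powr t) / q\<^sup>2 +
      2 * ((1 - (1 + q\<^sup>2) powr (t / 2)) / q\<^sup>2) +
      2 * ((1 + q\<^sup>2) powr (t / 2) * ((1 - cos (s * arctan q)) / q\<^sup>2)))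
      \<longlongrightarrow> (t - t\<^sup>2) + 2 * (- t / 2) + 2 * (1 * (s\<^sup>2 / 2))) (at_right 0)"
    by (intro tendsto_add tendsto_mult tendsto_const)
  then show ?thesis
    by (simp add: diff_divide_distrib add_divide_distrib algebra_simps)
qed

theorem theorem1p19:
  fixes \<beta> :: "(complex \<times> complex) set \<Rightarrow> (complex \<times> complex) set \<Rightarrow> real"
    and \<alpha> :: "(complex \<times> complex) set \<Rightarrow> (complex \<times> complex) set \<Rightarrow> (complex \<times> complex) set \<Rightarrow> real"
    and t s :: real
  assumes "\<And>x y. x \<in> HC1 \<Longrightarrow> y \<in> HC1 \<Longrightarrow> \<beta> x y = cosh (hdist x y)"
    and "\<And>x y z. x \<in> HC1 \<Longrightarrow> y \<in> HC1 \<Longrightarrow> z \<in> HC1 \<Longrightarrow> \<alpha> x y z = Cart x y z"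
    and "0 \<le> t" and "t \<le> 1"
    and "complex_hyperbolic_type HC1 (\<lambda>x y. \<beta> x y powr t) (\<lambda>x y z. s * \<alpha> x y z)"
  shows "s = t \<or> s = - t"
proof -
  have o: "disc_point 0 \<in> HC1"
    by (simp add: disc_point)
  then have "pos_type_on HC1 (\<lambda>x y. of_real (\<beta> x (disc_point 0) powr t * \<beta> (disc_point 0) y powr t) -
      cis (s * \<alpha> (disc_point 0) x y) * of_real (\<beta> x y powr t))"
    using assms(5) unfolding complex_hyperbolic_type_def by blast
  then have pos: "pos_type_on HC1 (deformed_kernel t s (disc_point 0))"
    by (rule pos_type_on_cong) (simp add: deformed_kernel_def assms(1,2) o)
  have small: "eventually (\<lambda>q. 0 < q \<and> q < 1) (at_right (0::real))"
    by (auto simp: eventually_at_right_field intro: exI[of _ 1])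
  have "\<sigma> * s \<le> t" if "\<sigma> = 1 \<or> \<sigma> = -1" for \<sigma>
  proof -
    have "0 \<le> t - \<sigma> * s"
      \<comment> \<open>The limit is used with \<open>\<sigma> * s\<close> for \<open>s\<close>, so
        the two signs give \<open>b >= 0\<close> and \<open>a >= 0\<close>.\<close>
      by (rule tendsto_lowerbound[OF two_point_limit])
        (use small two_point_inequality[OF pos _ _ that] in \<open>auto elim!: eventually_mono\<close>)
    then show ?thesis
      by simp
  qed
  from this[of 1] this[of "-1"] have "s\<^sup>2 \<le> t\<^sup>2"
    by (intro power2_le_iff_abs_le[THEN iffD2]) auto
  \<comment> \<open>This is \<open>a * b <= 0\<close>, the reverse of the previous
    inequality.\<close>
  moreover have "0 \<le> s\<^sup>2 - t\<^sup>2"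
    by (rule tendsto_lowerbound[OF four_point_limit])
      (use small four_point_inequality[OF pos] in \<open>auto elim!: eventually_mono\<close>)
  ultimately show ?thesis
    by (auto simp: power2_eq_iff)
qed
end
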